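(* Let $T>0$ and let $X=(X_t)_{t\in[0,T]}$ be a stochastic process with values in a separable normed space $(B,\|\cdot\|)$ on a probability space $(\Omega,\mathcal A,\mathbb P)$. Suppose there are positive constants $\alpha,\beta,C$ such that $$\mathbb E[\|X_t-X_s\|^\alpha]\le C|t-s|^{1+\beta}\qquad\text{for all }s,t\in[0,T].$$ (1) Then there exists a continuous modification $\tilde X=(\tilde X_t)_{t\in[0,T]}$ of $X$ which has locally H\"older continuous paths for any H\"older exponent $\gamma\in(0,\frac\beta\alpha)$. (2) For $\gamma\in(0,\frac\beta\alpha)$ let $$\mathfrak m(\omega):=\sup\Big\{n\in\mathbb N_0:\max_{\ell\in\{1,\dots,2^n\}}\big\|X_{T\frac{\ell}{2^n}}(\omega)-X_{T\frac{\ell-1}{2^n}}(\omega)\big\|>T^\gamma2^{-\gamma n}\Big\}.$$ Then almost surely, for all $n>\mathfrak m$, $$\max_{\ell\in\{1,\dots,2^n\}}\big\|X_{T\frac{\ell}{2^n}}-X_{T\frac{\ell-1}{2^n}}\big\|\le T^\gamma2^{-\gamma n},$$ and for all $k\ge1$ $$\mathbb P(\mathfrak m\ge k)\le2e^{9/8}\cdot\Big[k\Big(\frac{C\,T^{1+\beta-\gamma\alpha}\,(2^{\beta-\alpha\gamma}-1)}{1-2^{-(\beta-\alpha\gamma)}}+1\Big)+1\Big]\cdot2^{-k(\beta-\alpha\gamma)}.$$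
   Context: $\mathbb N_0=\{0,1,2,\dots\}$; $\sup\emptyset:=0$.
   Formalization: Part (1) fails for incomplete B, since limits of paths may leave B at random times; the formal statement gives a B-valued modification when B is complete, and for general separable normed B one with values in the completion of B. *)

theory Defs
  imports "HOL-Probability.Probability"
begin

definition modification ::
  "'w measure \<Rightarrow> 'i set \<Rightarrow> ('i \<Rightarrow> 'w \<Rightarrow> 'b::topological_space) \<Rightarrow> ('i \<Rightarrow> 'w \<Rightarrow> 'b) \<Rightarrow> bool"
where
  "modification M I X Y \<longleftrightarrow>
     (\<forall>t\<in>I. Y t \<in> borel_measurable M) \<and> (\<forall>t\<in>I. AE \<omega> in M. Y t \<omega> = X t \<omega>)"

(* Every point of S has a neighbourhood in S on which f is Holder continuous
   with exponent \<gamma>; the constant K may depend on the neighbourhood. *)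
definition locally_Holder_on ::
  "real \<Rightarrow> 'a::metric_space set \<Rightarrow> ('a \<Rightarrow> 'b::metric_space) \<Rightarrow> bool"
where
  "locally_Holder_on \<gamma> S f \<longleftrightarrow>
     (\<forall>t\<in>S. \<exists>\<epsilon>>0. \<exists>K. \<forall>r \<in> S \<inter> ball t \<epsilon>. \<forall>s \<in> S \<inter> ball t \<epsilon>.
        dist (f r) (f s) \<le> K * dist r s powr \<gamma>)"

(* Continuity and the Holder property hold on every path, not only on almost every path,
   and a single Y serves all exponents. *)
definition continuous_locally_Holder_modification ::
  "'w measure \<Rightarrow> real \<Rightarrow> real \<Rightarrow> (real \<Rightarrow> 'w \<Rightarrow> 'b::metric_space) \<Rightarrow> (real \<Rightarrow> 'w \<Rightarrow> 'b) \<Rightarrow> bool"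
where
  "continuous_locally_Holder_modification M T \<gamma>max X Y \<longleftrightarrow>
     modification M {0..T} X Y \<and>
     (\<forall>\<omega>\<in>space M. continuous_on {0..T} (\<lambda>t. Y t \<omega>)) \<and>
     (\<forall>\<omega>\<in>space M. \<forall>\<gamma>\<in>{0<..<\<gamma>max}. locally_Holder_on \<gamma> {0..T} (\<lambda>t. Y t \<omega>))"

definition max_dyadic_increment ::
  "real \<Rightarrow> (real \<Rightarrow> 'w \<Rightarrow> 'b::real_normed_vector) \<Rightarrow> nat \<Rightarrow> 'w \<Rightarrow> real"
where
  "max_dyadic_increment T X n \<omega> =
     Max ((\<lambda>l::nat. norm (X (T * real l / 2 ^ n) \<omega> - X (T * (real l - 1) / 2 ^ n) \<omega>)) ` {1..2 ^ n})"

(* The supremum is taken in the extended naturals: it is 0 for the empty set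
   and \<infinity> when infinitely many levels exceed the threshold. *)
definition last_exceedance ::
  "real \<Rightarrow> real \<Rightarrow> (real \<Rightarrow> 'w \<Rightarrow> 'b::real_normed_vector) \<Rightarrow> 'w \<Rightarrow> enat"
where
  "last_exceedance \<gamma> T X \<omega> =
     Sup {enat n | n. max_dyadic_increment T X n \<omega> > T powr \<gamma> * 2 powr (- \<gamma> * real n)}"

end

(* Kolmogorov-Chentsov by dyadic chaining.  Markov's inequality and a union bound make the
   probability that some increment of level n exceeds T^\<gamma> 2^(-\<gamma> n) at most a constant times
   2^(-n (\<beta> - \<alpha> \<gamma>)), which is summable.  By Borel-Cantelli, almost every path has geometrically
   small dyadic increments from some level on; along the dyadic points floor(2^n t / T) T / 2^n it
   is then Cauchy at every t at once, the limits form a Holder continuous path, and the limit at a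
   fixed t is X_t almost surely.  The tail of the last exceedance level is bounded by the same
   geometric series; the stated bound is at least that series or at least 1. *)
theory Submission imports Defs begin

section \<open>Sequences with geometrically decreasing steps\<close>

lemma geometric_chain_dist:
  fixes f :: "nat \<Rightarrow> 'a::metric_space"
  assumes step: "\<And>n. n \<ge> N \<Longrightarrow> dist (f (Suc n)) (f n) \<le> K * q ^ n"
    and q: "0 < q" "q < 1" and "N \<le> n"
  shows "dist (f (n + m)) (f n) \<le> K * q ^ n / (1 - q)"
proof -
  \<comment> \<open>A distance is at most \<open>K * q ^ N\<close> while \<open>q ^ N\<close> is
    positive, which forces the sign of \<open>K\<close>.\<close>
  have K: "0 \<le> K"
    using order_trans[OF zero_le_dist step[OF order_refl]] zero_less_power[OF q(1), of N]
    by (metis not_le zero_le_mult_iff)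
  \<comment> \<open>The induction carries the exact partial sum of the geometric series; the bound
    by the full series would not reproduce itself in the induction step.\<close>
  have "dist (f (n + m)) (f n) \<le> K * q ^ n * (1 - q ^ m) / (1 - q)"
  proof (induction m)
    case (Suc m)
    have "dist (f (n + Suc m)) (f n) \<le> dist (f (Suc (n + m))) (f (n + m)) + dist (f (n + m)) (f n)"
      by (simp add: dist_triangle)
    also have "\<dots> \<le> K * q ^ (n + m) + K * q ^ n * (1 - q ^ m) / (1 - q)"
      using step[of "n + m"] Suc \<open>N \<le> n\<close> by (intro add_mono) auto
    also have "\<dots> = K * q ^ n * (1 - q ^ Suc m) / (1 - q)"
      using q by (simp add: field_simps power_add)
    finally show ?case .
  qed simp
  also have "\<dots> \<le> K * q ^ n * 1 / (1 - q)"
    using K q by (intro divide_right_mono mult_left_mono) auto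
  finally show ?thesis by simp
qed

text \<open>Completeness is asked of a set \<open>S\<close> rather than of the type, so that the
  result serves both a complete space and a closed subset of a Banach space.\<close>

lemma geometric_chain_convergent:
  fixes f :: "nat \<Rightarrow> 'a::metric_space"
  assumes step: "\<And>n. n \<ge> N \<Longrightarrow> dist (f (Suc n)) (f n) \<le> K * q ^ n"
    and q: "0 < q" "q < 1"
    and S: "Topological_Spaces.complete S" "\<And>n. f n \<in> S"
  obtains l where "l \<in> S" "f \<longlonglongrightarrow> l"
proof -
  have lim: "(\<lambda>n. K * q ^ n / (1 - q)) \<longlonglongrightarrow> K * 0 / (1 - q)"
    using q by (intro tendsto_intros LIMSEQ_realpow_zero) auto
  have "Cauchy f"
  proof (rule metric_CauchyI)
    fix e :: real assume "0 < e"
    with order_tendstoD(2)[OF lim, of "e / 2"]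
    obtain M0 where M0: "\<And>n. n \<ge> M0 \<Longrightarrow> K * q ^ n / (1 - q) < e / 2"
      by (auto simp: eventually_sequentially)
    let ?M = "max M0 N"
    have *: "dist (f n) (f ?M) < e / 2" if "n \<ge> ?M" for n
    proof -
      have "dist (f (?M + (n - ?M))) (f ?M) \<le> K * q ^ ?M / (1 - q)"
        by (rule geometric_chain_dist[OF step q]) auto
      also have "\<dots> < e / 2" by (rule M0) simp
      finally show ?thesis using that by simp
    qed
    show "\<exists>M. \<forall>m\<ge>M. \<forall>n\<ge>M. dist (f m) (f n) < e"
      using dist_triangle_half_l[OF * *] by blast
  qed
  with S that show ?thesis unfolding complete_def by blast
qed

section \<open>Dyadic chaining along a single path\<close>

text \<open>For \<open>T > 0\<close> and \<open>t\<close> in \<open>{0..T}\<close> this numbers the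
  last grid point of level \<open>n\<close> that does not exceed \<open>t\<close>. At
  \<open>t = T\<close> it is \<open>2 ^ n\<close>, so the right endpoint is its own
  approximation.\<close>

definition dyadic_index :: "real \<Rightarrow> nat \<Rightarrow> real \<Rightarrow> nat" where
  "dyadic_index T n t = nat \<lfloor>2 ^ n * t / T\<rfloor>"

definition dyadic_floor :: "real \<Rightarrow> nat \<Rightarrow> real \<Rightarrow> real" where
  "dyadic_floor T n t = T * real (dyadic_index T n t) / 2 ^ n"

lemma dyadic_index_bounds:
  assumes "T > 0" "t \<in> {0..T}"
  shows "real (dyadic_index T n t) \<le> 2 ^ n * t / T" "2 ^ n * t / T < real (dyadic_index T n t) + 1"
    "dyadic_index T n t \<le> 2 ^ n"
proof -
  have *: "0 \<le> 2 ^ n * t / T" "2 ^ n * t / T \<le> 2 ^ n" using assms by (auto simp: field_simps)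
  show 1: "real (dyadic_index T n t) \<le> 2 ^ n * t / T" "2 ^ n * t / T < real (dyadic_index T n t) + 1"
    using *(1) unfolding dyadic_index_def by linarith+
  show "dyadic_index T n t \<le> 2 ^ n" using order_trans[OF 1(1) *(2)] by simp
qed

lemma dyadic_floor_in: "T > 0 \<Longrightarrow> t \<in> {0..T} \<Longrightarrow> dyadic_floor T n t \<in> {0..T}"
proof -
  assume a: "T > 0" "t \<in> {0..T}"
  have "real (dyadic_index T n t) \<le> real (2 ^ n)"
    using dyadic_index_bounds(3)[OF a, of n] by (simp only: of_nat_le_iff)
  with a show ?thesis by (auto simp: dyadic_floor_def field_simps)
qed

lemma dyadic_floor_dist:
  assumes "T > 0" "t \<in> {0..T}"
  shows "\<bar>dyadic_floor T n t - t\<bar> \<le> T / 2 ^ n"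
proof -
  have "\<bar>real (dyadic_index T n t) - 2 ^ n * t / T\<bar> \<le> 1"
    using dyadic_index_bounds[OF assms, of n] by linarith
  then have "T / 2 ^ n * \<bar>real (dyadic_index T n t) - 2 ^ n * t / T\<bar> \<le> T / 2 ^ n * 1"
    using assms by (intro mult_left_mono) auto
  also have "T / 2 ^ n * \<bar>real (dyadic_index T n t) - 2 ^ n * t / T\<bar>
      = \<bar>T / 2 ^ n * (real (dyadic_index T n t) - 2 ^ n * t / T)\<bar>"
    using assms by (simp add: abs_mult)
  also have "T / 2 ^ n * (real (dyadic_index T n t) - 2 ^ n * t / T) = dyadic_floor T n t - t"
    using assms by (simp add: dyadic_floor_def field_simps)
  finally show ?thesis by simp
qed

text \<open>The event behind \<open>max_dyadic_increment\<close>, for one path and with values in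
  any metric space; the maximum is replaced by a bounded quantifier.\<close>

definition dyadic_bound :: "real \<Rightarrow> (real \<Rightarrow> 'a::metric_space) \<Rightarrow> nat \<Rightarrow> real \<Rightarrow> bool" where
  "dyadic_bound T x n c \<longleftrightarrow>
     (\<forall>l\<in>{1..2 ^ n}. dist (x (T * real l / 2 ^ n)) (x (T * (real l - 1) / 2 ^ n)) \<le> c)"

text \<open>Comparing two integer parts yields indices that are equal or adjacent in either order,
  and this form covers all three cases. The equal case is where \<open>0 \<le> c\<close>
  enters.\<close>

lemma dyadic_boundD:
  assumes "dyadic_bound T x n c" "0 \<le> c" "i \<le> 2 ^ n" "j \<le> 2 ^ n" "i \<le> j + 1" "j \<le> i + 1"
  shows "dist (x (T * real i / 2 ^ n)) (x (T * real j / 2 ^ n)) \<le> c"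
proof -
  consider "i = j" | "i = Suc j" | "j = Suc i" using assms by linarith
  then show ?thesis
  proof cases
    case 2
    with assms(3) have "i \<in> {1..2 ^ n}" by auto
    with assms(1) have "dist (x (T * real i / 2 ^ n)) (x (T * (real i - 1) / 2 ^ n)) \<le> c"
      unfolding dyadic_bound_def by blast
    with 2 show ?thesis by simp
  next
    case 3
    with assms(4) have "j \<in> {1..2 ^ n}" by auto
    with assms(1) have "dist (x (T * real j / 2 ^ n)) (x (T * (real j - 1) / 2 ^ n)) \<le> c"
      unfolding dyadic_bound_def by blast
    with 3 show ?thesis by (simp add: dist_commute)
  qed (use assms in auto)
qed

context
  fixes T K q :: real and N :: nat and x :: "real \<Rightarrow> 'a::metric_space"
  assumes T: "T > 0" and K: "K \<ge> 0" and q: "0 < q" "q < 1"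
    and bound: "\<And>n. n \<ge> N \<Longrightarrow> dyadic_bound T x n (K * q ^ n)"
begin

text \<open>If \<open>t\<close> has index \<open>i\<close> at level \<open>n\<close>, then at level
  \<open>n + 1\<close> it has index \<open>2 * i\<close> or \<open>2 * i + 1\<close>. Both floors
  are therefore equal or neighbouring points of the finer grid.\<close>

lemma dyadic_floor_step:
  assumes t: "t \<in> {0..T}" and n: "n \<ge> N"
  shows "dist (x (dyadic_floor T (Suc n) t)) (x (dyadic_floor T n t)) \<le> K * q ^ n"
proof -
  let ?i = "dyadic_index T n t" and ?j = "dyadic_index T (Suc n) t"
  note b = dyadic_index_bounds[OF T t, of n] dyadic_index_bounds[OF T t, of "Suc n"]
  have s: "2 ^ Suc n * t / T = 2 * (2 ^ n * t / T)" by simp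
  have "real ?j < real (2 * ?i + 2)" "real (2 * ?i) < real (?j + 1)"
    using b(1,2,4,5) unfolding s by linarith+
  then have ij: "?j < 2 * ?i + 2" "2 * ?i < ?j + 1" by (simp_all only: of_nat_less_iff)
  have eq: "dyadic_floor T n t = T * real (2 * ?i) / 2 ^ Suc n"
    by (simp add: dyadic_floor_def)
  have "dist (x (T * real ?j / 2 ^ Suc n)) (x (T * real (2 * ?i) / 2 ^ Suc n)) \<le> K * q ^ Suc n"
    by (rule dyadic_boundD[OF bound]) (use n b ij K q in auto)
  also have "\<dots> \<le> K * q ^ n"
    using K q by (intro mult_left_mono) (auto simp: mult_left_le_one_le)
  finally show ?thesis unfolding eq by (simp add: dyadic_floor_def)
qed

lemma dyadic_limit_exists:
  assumes "Topological_Spaces.complete S" "\<And>t. t \<in> {0..T} \<Longrightarrow> x t \<in> S" "t \<in> {0..T}"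
  obtains l where "l \<in> S" "(\<lambda>n. x (dyadic_floor T n t)) \<longlonglongrightarrow> l"
  by (rule geometric_chain_convergent[where f="\<lambda>n. x (dyadic_floor T n t)" and N=N and K=K and q=q and S=S])
     (use assms q dyadic_floor_step dyadic_floor_in[OF T] that in auto)

text \<open>Each limit lies within the geometric tail \<open>K * q ^ n / (1 - q)\<close> of its
  value at the level \<open>n\<close> floor, and the floors of two times at distance at most
  \<open>T / 2 ^ n\<close> are equal or adjacent.\<close>

lemma dyadic_limit_increment:
  assumes st: "s \<in> {0..T}" "t \<in> {0..T}"
    and lim: "(\<lambda>n. x (dyadic_floor T n s)) \<longlonglongrightarrow> ys" "(\<lambda>n. x (dyadic_floor T n t)) \<longlonglongrightarrow> yt"
    and n: "n \<ge> N" and close: "\<bar>s - t\<bar> \<le> T / 2 ^ n"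
  shows "dist ys yt \<le> (2 * K / (1 - q) + K) * q ^ n"
proof -
  have approx: "dist y (x (dyadic_floor T n r)) \<le> K * q ^ n / (1 - q)"
    if r: "r \<in> {0..T}" and l: "(\<lambda>n. x (dyadic_floor T n r)) \<longlonglongrightarrow> y" for r y
  proof (rule LIMSEQ_le_const2)
    show "(\<lambda>m. dist (x (dyadic_floor T (m + n) r)) (x (dyadic_floor T n r)))
            \<longlonglongrightarrow> dist y (x (dyadic_floor T n r))"
      using l by (intro tendsto_intros LIMSEQ_ignore_initial_segment)
    have "dist (x (dyadic_floor T (n + m) r)) (x (dyadic_floor T n r)) \<le> K * q ^ n / (1 - q)" for m
      by (rule geometric_chain_dist[where f="\<lambda>n. x (dyadic_floor T n r)", OF dyadic_floor_step[OF r] q n])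
    then show "\<exists>N. \<forall>m\<ge>N. dist (x (dyadic_floor T (m + n) r)) (x (dyadic_floor T n r)) \<le> K * q ^ n / (1 - q)"
      by (auto simp: add.commute)
  qed
  let ?i = "dyadic_index T n s" and ?j = "dyadic_index T n t"
  note b = dyadic_index_bounds[OF T st(1), of n] dyadic_index_bounds[OF T st(2), of n]
  have "2 ^ n * s / T - 2 ^ n * t / T = 2 ^ n / T * (s - t)"
    using T by (simp add: field_simps)
  also have "\<bar>\<dots>\<bar> = 2 ^ n / T * \<bar>s - t\<bar>"
    using T by (simp add: abs_mult)
  also have "\<dots> \<le> 2 ^ n / T * (T / 2 ^ n)"
    using close T by (intro mult_left_mono) auto
  finally have "\<bar>2 ^ n * s / T - 2 ^ n * t / T\<bar> \<le> 1"
    using T by simp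
  \<comment> \<open>Rescaled times that differ by at most 1 have integer parts that differ by at
    most 1.\<close>
  then have "real ?i < real (?j + 2)" "real ?j < real (?i + 2)"
    using b(1,2,4,5) by linarith+
  then have ij: "?i < ?j + 2" "?j < ?i + 2" by (simp_all only: of_nat_less_iff)
  have mid: "dist (x (dyadic_floor T n s)) (x (dyadic_floor T n t)) \<le> K * q ^ n"
    unfolding dyadic_floor_def
    by (rule dyadic_boundD[OF bound[OF n]]) (use b ij K q in auto)
  have "dist ys yt \<le> dist ys (x (dyadic_floor T n s))
      + dist (x (dyadic_floor T n s)) (x (dyadic_floor T n t)) + dist yt (x (dyadic_floor T n t))"
    by metric
  also have "\<dots> \<le> K * q ^ n / (1 - q) + K * q ^ n + K * q ^ n / (1 - q)"
    by (intro add_mono approx mid st lim)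
  also have "\<dots> = (2 * K / (1 - q) + K) * q ^ n"
    by (simp add: field_simps)
  finally show ?thesis .
qed

text \<open>With \<open>q = 2 powr (- \<gamma>)\<close>, the bound \<open>q ^ n\<close> at level
  \<open>n\<close> is the mesh \<open>1 / 2 ^ n\<close> to the power \<gamma>. Matching the level to
  the distance of two times turns the increment bound into a Holder bound.\<close>

lemma dyadic_limit_Holder:
  assumes lim: "\<And>t. t \<in> {0..T} \<Longrightarrow> (\<lambda>n. x (dyadic_floor T n t)) \<longlonglongrightarrow> y t"
    and q_eq: "q = 2 powr (- \<gamma>)"
  shows "locally_Holder_on \<gamma> {0..T} y"
proof -
  define L where "L = 2 * K / (1 - q) + K"
  have L: "L \<ge> 0" unfolding L_def using K q by simp
  \<comment> \<open>Positivity of the exponent is encoded in \<open>q < 1\<close>.\<close>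
  have \<gamma>: "\<gamma> > 0" 
    using q(2) ge_one_powr_ge_zero[of 2 "- \<gamma>"] unfolding q_eq by linarith
  have main: "dist (y r) (y s) \<le> L * 2 powr \<gamma> / T powr \<gamma> * dist r s powr \<gamma>"
    if rs: "r \<in> {0..T}" "s \<in> {0..T}" and near: "dist r s < T / 2 ^ N" for r s
  proof (cases "r = s")
    case False
    define u where "u = dist r s / T"
    have u: "u > 0" "u < 1 / 2 ^ N" using False near T by (auto simp: u_def field_simps)
    have ex: "\<exists>n. 1 / 2 ^ n < u"
      using reals_Archimedean2[of "1 / u"] less_exp of_nat_less_two_power[where 'a=real] u
      by (metis divide_less_eq less_trans mult.commute zero_less_numeral zero_less_power)
    \<comment> \<open>The level before the least \<open>m\<close> satisfies
      \<open>1 / 2 ^ (n + 1) < u \<le> 1 / 2 ^ n\<close>. Since \<open>u < 1 / 2 ^ N\<close>, the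
      number \<open>m\<close> exceeds \<open>N\<close>, so \<open>n = m - 1\<close> still lies in
      the range of the increment bound.\<close>
    define m where "m = (LEAST n. 1 / 2 ^ n < u)"
    have m: "1 / 2 ^ m < u" unfolding m_def by (rule LeastI_ex[OF ex])
    have "N < m"
    proof (rule ccontr)
      assume "\<not> N < m"
      then have "(1::real) / 2 ^ N \<le> 1 / 2 ^ m" by (intro divide_left_mono power_increasing) auto
      with m u show False by linarith
    qed
    then obtain n where n: "m = Suc n" "N \<le> n" by (cases m) auto
    have un: "u \<le> 1 / 2 ^ n"
      using not_less_Least[of n "\<lambda>n. 1 / 2 ^ n < u"] n unfolding m_def[symmetric] by simp
    have "\<bar>r - s\<bar> \<le> T / 2 ^ n"
      using un T by (simp add: u_def dist_real_def field_simps)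
    then have "dist (y r) (y s) \<le> L * q ^ n"
      unfolding L_def by (intro dyadic_limit_increment[OF rs lim[OF rs(1)] lim[OF rs(2)] n(2)])
    \<comment> \<open>Passing from \<open>n\<close> to \<open>m = n + 1\<close> costs the factor
      \<open>2 powr \<gamma>\<close>; then \<open>1 / 2 ^ m\<close> can be replaced by the larger
      \<open>u\<close>.\<close>
    also have "q ^ n = 2 powr \<gamma> * (1 / 2 ^ m) powr \<gamma>"
      by (simp add: q_eq n powr_powr powr_divide powr_mult powr_realpow[symmetric] field_simps
          flip: powr_add powr_diff)
    also have "L * (2 powr \<gamma> * (1 / 2 ^ m) powr \<gamma>) \<le> L * (2 powr \<gamma> * u powr \<gamma>)"
      using L m u \<gamma> by (intro mult_left_mono powr_mono2) auto
    also have "\<dots> = L * 2 powr \<gamma> / T powr \<gamma> * dist r s powr \<gamma>"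
      using T by (simp add: u_def powr_divide)
    finally show ?thesis .
  qed simp
  show ?thesis unfolding locally_Holder_on_def
  proof
    fix t assume "t \<in> {0..T}"
    show "\<exists>\<epsilon>>0. \<exists>K. \<forall>r\<in>{0..T} \<inter> ball t \<epsilon>. \<forall>s\<in>{0..T} \<inter> ball t \<epsilon>.
        dist (y r) (y s) \<le> K * dist r s powr \<gamma>"
    proof (intro exI conjI ballI)
      \<comment> \<open>Half the admissible distance is taken as radius, so that any two points of
        the ball are close enough for \<open>main\<close>.\<close>
      show "T / 2 ^ N / 2 > 0" using T by simp
      fix r s assume "r \<in> {0..T} \<inter> ball t (T / 2 ^ N / 2)" "s \<in> {0..T} \<inter> ball t (T / 2 ^ N / 2)"
      then show "dist (y r) (y s) \<le> L * 2 powr \<gamma> / T powr \<gamma> * dist r s powr \<gamma>"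
        using dist_triangle_half_r[of t r "T / 2 ^ N" s] by (intro main) (auto simp: dist_commute)
    qed
  qed
qed

end

lemma locally_Holder_on_imp_continuous_on:
  assumes "locally_Holder_on \<gamma> S f" "\<gamma> > 0"
  shows "continuous_on S f"
  unfolding continuous_on_def
proof
  fix t assume t: "t \<in> S"
  with assms(1) obtain e K where e: "e > 0"
    and H: "\<And>r s. r \<in> S \<inter> ball t e \<Longrightarrow> s \<in> S \<inter> ball t e \<Longrightarrow> dist (f r) (f s) \<le> K * dist r s powr \<gamma>"
    unfolding locally_Holder_on_def by metis
  have "((\<lambda>r. K * dist r t powr \<gamma>) \<longlongrightarrow> K * 0 powr \<gamma>) (at t within S)"
    using assms(2) by (intro tendsto_intros tendsto_powr' tendsto_dist_iff[THEN iffD1]) auto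
  then have lim: "((\<lambda>r. K * dist r t powr \<gamma>) \<longlongrightarrow> 0) (at t within S)" by simp
  have "\<forall>\<^sub>F r in at t within S. dist (f r) (f t) \<le> K * dist r t powr \<gamma>"
    unfolding eventually_at using e t H[of _ t] by (auto simp: dist_commute)
  then have "((\<lambda>r. dist (f r) (f t)) \<longlongrightarrow> 0) (at t within S)"
    by (intro tendsto_sandwich[OF _ _ tendsto_const lim]) auto
  then show "(f \<longlongrightarrow> f t) (at t within S)" by (rule tendsto_dist_iff[THEN iffD2])
qed


section \<open>Probabilities of large dyadic increments\<close>

lemma two_powr_minus_bounds: "d > 0 \<Longrightarrow> 0 < 2 powr (- d) \<and> 2 powr (- d) < (1::real)"
  using powr_less_cancel_iff[of 2 "- d" 0] by simp

text \<open>Values lie in a metric space so that the locale applies both to the process and to its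
  image in a Banach space. Measurability of the distances is a separate assumption because it does
  not follow from measurability of the variables in a space that is not second countable.\<close>

locale moment_increments = prob_space M for M :: "'w measure" +
  fixes X :: "real \<Rightarrow> 'w \<Rightarrow> 'e::metric_space" and T \<alpha> \<beta> C :: real
  assumes T_pos: "T > 0" and \<alpha>_pos: "\<alpha> > 0" and \<beta>_pos: "\<beta> > 0" and C_pos: "C > 0"
    and X_measurable: "t \<in> {0..T} \<Longrightarrow> X t \<in> borel_measurable M"
    and dist_measurable:
      "s \<in> {0..T} \<Longrightarrow> t \<in> {0..T} \<Longrightarrow> (\<lambda>\<omega>. dist (X s \<omega>) (X t \<omega>)) \<in> borel_measurable M"
    and moment: "s \<in> {0..T} \<Longrightarrow> t \<in> {0..T} \<Longrightarrow>
      (\<integral>\<^sup>+\<omega>. ennreal (dist (X s \<omega>) (X t \<omega>) powr \<alpha>) \<partial>M) \<le> ennreal (C * \<bar>s - t\<bar> powr (1 + \<beta>))"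
begin

lemma increment_event:
  "s \<in> {0..T} \<Longrightarrow> t \<in> {0..T} \<Longrightarrow> {\<omega>\<in>space M. dist (X s \<omega>) (X t \<omega>) > c} \<in> events"
  using dist_measurable[of s t] by measurable

text \<open>Markov's inequality for the \<alpha>-th power of the distance, with threshold
  \<open>c powr \<alpha>\<close>.\<close>

lemma prob_increment:
  assumes st: "s \<in> {0..T}" "t \<in> {0..T}" and c: "c > 0"
  shows "prob {\<omega>\<in>space M. dist (X s \<omega>) (X t \<omega>) > c} \<le> C * \<bar>s - t\<bar> powr (1 + \<beta>) / c powr \<alpha>"
proof -
  have [measurable]: "(\<lambda>\<omega>. dist (X s \<omega>) (X t \<omega>)) \<in> borel_measurable M"
    by (rule dist_measurable[OF st])
  let ?u = "\<lambda>\<omega>. ennreal (dist (X s \<omega>) (X t \<omega>) powr \<alpha>)"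
  have "emeasure M {\<omega>\<in>space M. dist (X s \<omega>) (X t \<omega>) > c}
      \<le> emeasure M {\<omega>\<in>space M. 1 \<le> ennreal (1 / c powr \<alpha>) * ?u \<omega>}"
  proof (rule emeasure_mono)
    show "{\<omega>\<in>space M. dist (X s \<omega>) (X t \<omega>) > c}
        \<subseteq> {\<omega>\<in>space M. 1 \<le> ennreal (1 / c powr \<alpha>) * ?u \<omega>}"
    proof safe
      fix \<omega> assume "c < dist (X s \<omega>) (X t \<omega>)"
      then have "c powr \<alpha> \<le> dist (X s \<omega>) (X t \<omega>) powr \<alpha>"
        using c \<alpha>_pos by (intro powr_mono2) auto
      then have "1 \<le> 1 / c powr \<alpha> * dist (X s \<omega>) (X t \<omega>) powr \<alpha>"
        using c by simp
      then show "1 \<le> ennreal (1 / c powr \<alpha>) * ?u \<omega>"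
        by (subst ennreal_mult[symmetric]) auto
    qed
  qed measurable
  also have "\<dots> \<le> ennreal (1 / c powr \<alpha>) * (\<integral>\<^sup>+\<omega>. ?u \<omega> * indicator (space M) \<omega> \<partial>M)"
    by (rule nn_integral_Markov_inequality) auto
  also have "(\<integral>\<^sup>+\<omega>. ?u \<omega> * indicator (space M) \<omega> \<partial>M) = (\<integral>\<^sup>+\<omega>. ?u \<omega> \<partial>M)"
    by (intro nn_integral_cong) auto
  also have "ennreal (1 / c powr \<alpha>) * \<dots> \<le> ennreal (1 / c powr \<alpha>) * ennreal (C * \<bar>s - t\<bar> powr (1 + \<beta>))"
    by (intro mult_left_mono moment st) auto
  also have "\<dots> = ennreal (C * \<bar>s - t\<bar> powr (1 + \<beta>) / c powr \<alpha>)"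
    using C_pos by (subst ennreal_mult[symmetric]) auto
  finally show ?thesis
    using C_pos by (simp add: emeasure_eq_measure)
qed

text \<open>The threshold is written as a power with natural exponent, the form in which the
  chaining lemmas and the geometric series use it.\<close>

definition exceedance :: "real \<Rightarrow> nat \<Rightarrow> 'w set" where
  "exceedance \<gamma> n =
     {\<omega>\<in>space M. \<not> dyadic_bound T (\<lambda>t. X t \<omega>) n (T powr \<gamma> * (2 powr (- \<gamma>)) ^ n)}"

lemma dyadic_point_in: "l \<in> {1..2 ^ n} \<Longrightarrow> T * real l / 2 ^ n \<in> {0..T}"
  "l \<in> {1..2 ^ n} \<Longrightarrow> T * (real l - 1) / 2 ^ n \<in> {0..T}"
proof -
  assume "l \<in> {1..2 ^ n}"
  then have l: "1 \<le> l" and "real l \<le> real (2 ^ n)" by (auto simp del: of_nat_power)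
  then have l': "real l \<le> 2 ^ n" by simp
  then show "T * real l / 2 ^ n \<in> {0..T}" using T_pos by (auto simp: field_simps)
  have "T * (real l - 1) \<le> T * 2 ^ n" using T_pos l' by (intro mult_left_mono) linarith+
  then show "T * (real l - 1) / 2 ^ n \<in> {0..T}" using T_pos l by (auto simp: field_simps)
qed

lemma exceedance_eq_UN:
  "exceedance \<gamma> n = (\<Union>l\<in>{1..2 ^ n}. {\<omega>\<in>space M.
     dist (X (T * real l / 2 ^ n) \<omega>) (X (T * (real l - 1) / 2 ^ n) \<omega>) > T powr \<gamma> * (2 powr (- \<gamma>)) ^ n})"
  by (auto simp: exceedance_def dyadic_bound_def not_le)

lemma exceedance_event [measurable]: "exceedance \<gamma> n \<in> events"
  unfolding exceedance_eq_UN by (intro sets.finite_UN increment_event dyadic_point_in) auto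

text \<open>A union bound over \<open>2 ^ n\<close> increments of length \<open>T / 2 ^ n\<close>.
  The summand 1 in the exponent \<open>1 + \<beta>\<close> pays for the number of increments, and
  the threshold costs \<open>2 powr (\<alpha> * \<gamma> * n)\<close>.\<close>

lemma prob_exceedance:
  "prob (exceedance \<gamma> n) \<le> C * T powr (1 + \<beta> - \<gamma> * \<alpha>) * (2 powr (- (\<beta> - \<alpha> * \<gamma>))) ^ n"
proof -
  let ?c = "T powr \<gamma> * (2 powr (- \<gamma>)) ^ n"
  let ?A = "\<lambda>l. {\<omega>\<in>space M. dist (X (T * real l / 2 ^ n) \<omega>) (X (T * (real l - 1) / 2 ^ n) \<omega>) > ?c}"
  have "prob (exceedance \<gamma> n) \<le> (\<Sum>l\<in>{1..2 ^ n}. prob (?A l))"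
    unfolding exceedance_eq_UN
    by (intro finite_measure_subadditive_finite) (auto intro!: increment_event dyadic_point_in)
  also have "\<dots> \<le> (\<Sum>l\<in>{1..2 ^ n::nat}. C * (T / 2 ^ n) powr (1 + \<beta>) / ?c powr \<alpha>)"
  proof (rule sum_mono)
    fix l :: nat assume l: "l \<in> {1..2 ^ n}"
    have "\<bar>T * real l / 2 ^ n - T * (real l - 1) / 2 ^ n\<bar> = T / 2 ^ n"
      using T_pos by (simp add: field_simps)
    with prob_increment[OF dyadic_point_in[OF l], of ?c]
    show "prob (?A l) \<le> C * (T / 2 ^ n) powr (1 + \<beta>) / ?c powr \<alpha>"
      using T_pos by simp
  qed
  also have "\<dots> = C * (2 ^ n * (T / 2 ^ n) powr (1 + \<beta>) / ?c powr \<alpha>)"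
    by simp
  also have "2 ^ n * (T / 2 ^ n) powr (1 + \<beta>) / ?c powr \<alpha>
      = T powr (1 + \<beta> - \<gamma> * \<alpha>) * (2 powr (- (\<beta> - \<alpha> * \<gamma>))) ^ n"
    using T_pos
    by (simp add: powr_divide powr_mult powr_powr powr_power powr_realpow[symmetric]
        powr_add powr_diff powr_minus field_simps)
  finally show ?thesis by (simp add: mult.assoc)
qed

lemma summable_exceedance:
  assumes "\<gamma> < \<beta> / \<alpha>"
  shows "summable (\<lambda>n. prob (exceedance \<gamma> n))"
proof (rule summable_comparison_test')
  show "summable (\<lambda>n. C * T powr (1 + \<beta> - \<gamma> * \<alpha>) * (2 powr (- (\<beta> - \<alpha> * \<gamma>))) ^ n)"
    using two_powr_minus_bounds[of "\<beta> - \<alpha> * \<gamma>"] assms \<alpha>_pos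
    by (intro summable_mult summable_geometric) (auto simp: field_simps)
  show "norm (prob (exceedance \<gamma> n)) \<le> C * T powr (1 + \<beta> - \<gamma> * \<alpha>) * (2 powr (- (\<beta> - \<alpha> * \<gamma>))) ^ n"
    if "n \<ge> 0" for n
    using prob_exceedance by simp
qed

lemma AE_eventually_not_exceedance:
  assumes "\<gamma> < \<beta> / \<alpha>"
  shows "AE \<omega> in M. \<forall>\<^sub>F n in sequentially. \<omega> \<notin> exceedance \<gamma> n"
proof -
  have "AE \<omega> in M. \<forall>\<^sub>F n in sequentially. \<omega> \<in> space M - exceedance \<gamma> n"
    by (rule borel_cantelli_AE1) (auto simp: summable_exceedance assms emeasure_eq_measure)
  then show ?thesis by (auto elim!: eventually_mono)
qed

text \<open>Countable subadditivity, followed by summing the geometric bounds from level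
  \<open>k\<close> on.\<close>

lemma prob_exceedance_tail:
  assumes "\<gamma> < \<beta> / \<alpha>"
  shows "prob (\<Union>n. exceedance \<gamma> (n + k))
    \<le> C * T powr (1 + \<beta> - \<gamma> * \<alpha>) * 2 powr (- real k * (\<beta> - \<alpha> * \<gamma>)) / (1 - 2 powr (- (\<beta> - \<alpha> * \<gamma>)))"
proof -
  define q :: real where "q = 2 powr (- (\<beta> - \<alpha> * \<gamma>))"
  define A where "A = C * T powr (1 + \<beta> - \<gamma> * \<alpha>)"
  have q: "0 < q" "q < 1"
    using two_powr_minus_bounds[of "\<beta> - \<alpha> * \<gamma>"] assms \<alpha>_pos by (auto simp: field_simps q_def)
  have sm: "summable (\<lambda>n. prob (exceedance \<gamma> (n + k)))"
    using summable_exceedance[OF assms] by (subst summable_iff_shift)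
  have "(\<lambda>n. A * q ^ k * q ^ n) sums (A * q ^ k * (1 / (1 - q)))"
    using q by (intro sums_mult geometric_sums) auto
  then have sums: "(\<lambda>n. A * q ^ (n + k)) sums (A * q ^ k / (1 - q))"
    by (simp add: power_add mult_ac)
  have "prob (\<Union>n. exceedance \<gamma> (n + k)) \<le> (\<Sum>n. prob (exceedance \<gamma> (n + k)))"
    using sm by (intro finite_measure_subadditive_countably) auto
  also have "\<dots> \<le> (\<Sum>n. A * q ^ (n + k))"
    using sm sums_summable[OF sums] prob_exceedance unfolding A_def q_def by (intro suminf_le) auto
  also have "\<dots> = A * q ^ k / (1 - q)"
    by (rule sums_unique[OF sums, symmetric])
  also have "q ^ k = 2 powr (- real k * (\<beta> - \<alpha> * \<gamma>))"
    by (simp add: q_def powr_power algebra_simps)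
  finally show ?thesis by (simp add: A_def q_def)
qed

section \<open>Construction of the modification\<close>

text \<open>Borel-Cantelli for the distances between \<open>X t\<close> and its values at the floors
  of \<open>t\<close>. The exceptional null set may depend on \<open>t\<close>.\<close>

lemma AE_tendsto_dyadic_floor:
  assumes t: "t \<in> {0..T}"
  shows "AE \<omega> in M. (\<lambda>n. X (dyadic_floor T n t) \<omega>) \<longlonglongrightarrow> X t \<omega>"
proof -
  \<comment> \<open>The critical exponent is allowed here because each level contributes a single
    increment: the threshold \<open>q ^ n\<close> uses up exactly
    \<open>2 powr (- \<beta> * n)\<close>, and the summable factor \<open>(1 / 2) ^ n\<close>
    remains.\<close>
  define \<gamma> where "\<gamma> = \<beta> / \<alpha>"
  define q :: real where "q = 2 powr (- \<gamma>)"
  have q: "0 < q" "q < 1"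
    using two_powr_minus_bounds[of \<gamma>] \<alpha>_pos \<beta>_pos by (auto simp: \<gamma>_def q_def)
  define B where "B n = {\<omega>\<in>space M. dist (X (dyadic_floor T n t) \<omega>) (X t \<omega>) > q ^ n}" for n
  have B_event: "B n \<in> events" for n
    unfolding B_def by (intro increment_event dyadic_floor_in T_pos t)
  have B_prob: "prob (B n) \<le> C * T powr (1 + \<beta>) * (1 / 2) ^ n" for n
  proof -
    have "prob (B n) \<le> C * \<bar>dyadic_floor T n t - t\<bar> powr (1 + \<beta>) / (q ^ n) powr \<alpha>"
      unfolding B_def using q by (intro prob_increment dyadic_floor_in T_pos t) auto
    also have "\<dots> \<le> C * (T / 2 ^ n) powr (1 + \<beta>) / (q ^ n) powr \<alpha>"
      using C_pos \<beta>_pos dyadic_floor_dist[OF T_pos t]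
      by (intro divide_right_mono mult_left_mono powr_mono2) auto
    also have "(q ^ n) powr \<alpha> = 2 powr (- \<beta> * real n)"
      using \<alpha>_pos by (simp add: q_def \<gamma>_def powr_power powr_powr mult.commute)
    also have "(T / 2 ^ n) powr (1 + \<beta>) = T powr (1 + \<beta>) * (1 / 2) ^ n * 2 powr (- \<beta> * real n)"
      using T_pos
      by (simp add: powr_divide powr_powr powr_realpow[symmetric] powr_add powr_minus field_simps)
    finally show ?thesis by simp
  qed
  have "summable (\<lambda>n. prob (B n))"
  proof (rule summable_comparison_test')
    show "summable (\<lambda>n. C * T powr (1 + \<beta>) * (1 / 2) ^ n)"
      by (intro summable_mult summable_geometric) auto
  qed (use B_prob in auto)
  then have "AE \<omega> in M. \<forall>\<^sub>F n in sequentially. \<omega> \<in> space M - B n"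
    by (intro borel_cantelli_AE1) (auto simp: B_event emeasure_eq_measure)
  then show ?thesis
  proof eventually_elim
    case (elim \<omega>)
    have "(\<lambda>n. dist (X (dyadic_floor T n t) \<omega>) (X t \<omega>)) \<longlonglongrightarrow> 0"
    proof (rule tendsto_sandwich[OF _ _ tendsto_const LIMSEQ_realpow_zero])
      show "\<forall>\<^sub>F n in sequentially. dist (X (dyadic_floor T n t) \<omega>) (X t \<omega>) \<le> q ^ n"
        using elim by eventually_elim (auto simp: B_def)
    qed (use q in auto)
    then show ?case by (rule tendsto_dist_iff[THEN iffD2])
  qed
qed

text \<open>One good event of probability 1 handles a sequence of exponents tending to
  \<open>\<beta> / \<alpha>\<close>, so a single process serves all exponents. On it the paths are
  limits along dyadic floors; off it they are constant.\<close>

lemma exists_Holder_modification: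
  assumes S: "Topological_Spaces.complete S" "\<And>t \<omega>. t \<in> {0..T} \<Longrightarrow> \<omega> \<in> space M \<Longrightarrow> X t \<omega> \<in> S"
  shows "\<exists>Y. (\<forall>t\<in>{0..T}. \<forall>\<omega>\<in>space M. Y t \<omega> \<in> S) \<and>
    continuous_locally_Holder_modification M T (\<beta> / \<alpha>) X Y"
proof -
  obtain x0 where x0: "x0 \<in> S" using S(2)[of 0] not_empty T_pos by fastforce
  \<comment> \<open>\<open>g j\<close> may be negative for small \<open>j\<close>; summability needs only \<open>g j < \<beta> / \<alpha>\<close>.\<close>
  define g where "g j = \<beta> / \<alpha> - 1 / real (Suc j)" for j
  have g: "g j < \<beta> / \<alpha>" for j by (simp add: g_def)
  define G where "G = {\<omega>\<in>space M. \<forall>j. \<forall>\<^sub>F n in sequentially. \<omega> \<notin> exceedance (g j) n}"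
  have G_event [measurable]: "G \<in> events"
    \<comment> \<open>Spelled out, the condition has only quantifiers over natural numbers, hence
      describes an event.\<close>
    unfolding G_def eventually_sequentially by measurable
  have G_AE: "AE \<omega> in M. \<omega> \<in> G"
  proof -
    have "AE \<omega> in M. \<forall>j. \<forall>\<^sub>F n in sequentially. \<omega> \<notin> exceedance (g j) n"
      unfolding AE_all_countable by (intro allI AE_eventually_not_exceedance g)
    then show ?thesis by (rule AE_mp) (auto intro!: AE_I2 simp: G_def)
  qed
  \<comment> \<open>Any \<gamma> below the critical value is at most some \<open>g j\<close>, and
    the bound for the larger exponent implies the one for \<gamma>.\<close>
  have G_bound: "\<exists>K\<ge>0. \<exists>N. \<forall>n\<ge>N. dyadic_bound T (\<lambda>t. X t \<omega>) n (K * (2 powr (- \<gamma>)) ^ n)"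
    if \<omega>: "\<omega> \<in> G" and \<gamma>: "\<gamma> < \<beta> / \<alpha>" for \<omega> \<gamma>
  proof -
    obtain j where "1 / real (Suc j) < \<beta> / \<alpha> - \<gamma>"
      using reals_Archimedean[of "\<beta> / \<alpha> - \<gamma>"] \<gamma> by (auto simp: inverse_eq_divide)
    then have j: "\<gamma> \<le> g j" by (simp add: g_def)
    from \<omega> obtain N where N: "\<And>n. n \<ge> N \<Longrightarrow> \<omega> \<notin> exceedance (g j) n" and "\<omega> \<in> space M"
      unfolding G_def eventually_sequentially by blast
    have "dyadic_bound T (\<lambda>t. X t \<omega>) n (T powr g j * (2 powr (- \<gamma>)) ^ n)" if "n \<ge> N" for n
    proof -
      have "dyadic_bound T (\<lambda>t. X t \<omega>) n (T powr g j * (2 powr (- g j)) ^ n)"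
        using N[OF that] \<open>\<omega> \<in> space M\<close> by (simp add: exceedance_def)
      moreover have "T powr g j * (2 powr (- g j)) ^ n \<le> T powr g j * (2 powr (- \<gamma>)) ^ n"
        using j by (intro mult_left_mono power_mono powr_mono) auto
      ultimately show ?thesis unfolding dyadic_bound_def by (meson order_trans)
    qed
    then show ?thesis by (intro exI[of _ "T powr g j"] conjI exI[of _ N]) auto
  qed
  \<comment> \<open>The fallback \<open>x0\<close> is a value of the process, so it lies in
    \<open>S\<close>; a constant path is Holder continuous for every exponent.\<close>
  define Y where "Y t \<omega> = (if \<omega> \<in> G then lim (\<lambda>n. X (dyadic_floor T n t) \<omega>) else x0)" for t \<omega>
  have Y: "(\<lambda>n. X (dyadic_floor T n t) \<omega>) \<longlonglongrightarrow> Y t \<omega>" "Y t \<omega> \<in> S"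
    if \<omega>: "\<omega> \<in> G" and t: "t \<in> {0..T}" for \<omega> t
  proof -
    obtain \<gamma> where \<gamma>: "0 < \<gamma>" "\<gamma> < \<beta> / \<alpha>"
      using dense[OF divide_pos_pos[OF \<beta>_pos \<alpha>_pos]] by blast
    obtain K N where KN: "K \<ge> 0"
      "\<And>n. n \<ge> N \<Longrightarrow> dyadic_bound T (\<lambda>t. X t \<omega>) n (K * (2 powr (- \<gamma>)) ^ n)"
      using G_bound[OF \<omega> \<gamma>(2)] by blast
    have "\<omega> \<in> space M" using \<omega> by (simp add: G_def)
    then obtain l where "l \<in> S" "(\<lambda>n. X (dyadic_floor T n t) \<omega>) \<longlonglongrightarrow> l"
      using dyadic_limit_exists[where x="\<lambda>t. X t \<omega>", OF T_pos KN(1) _ _ KN(2) S(1) _ t]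
        two_powr_minus_bounds[OF \<gamma>(1)] S(2) by blast
    then show "(\<lambda>n. X (dyadic_floor T n t) \<omega>) \<longlonglongrightarrow> Y t \<omega>" "Y t \<omega> \<in> S"
      using \<omega> by (auto simp: Y_def limI)
  qed
  have Holder: "locally_Holder_on \<gamma> {0..T} (\<lambda>t. Y t \<omega>)"
    if \<gamma>: "0 < \<gamma>" "\<gamma> < \<beta> / \<alpha>" for \<omega> \<gamma>
  proof (cases "\<omega> \<in> G")
    case True
    obtain K N where KN: "K \<ge> 0"
      "\<And>n. n \<ge> N \<Longrightarrow> dyadic_bound T (\<lambda>t. X t \<omega>) n (K * (2 powr (- \<gamma>)) ^ n)"
      using G_bound[OF True \<gamma>(2)] by blast
    show ?thesis
      by (rule dyadic_limit_Holder[where x="\<lambda>t. X t \<omega>", OF T_pos KN(1) _ _ KN(2)])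
        (use two_powr_minus_bounds[OF \<gamma>(1)] Y(1)[OF True] in auto)
  next
    case False
    then show ?thesis
      unfolding locally_Holder_on_def Y_def
      by (intro ballI exI[of _ "1::real"] conjI exI[of _ "0::real"]) auto
  qed
  have meas: "Y t \<in> borel_measurable M" if t: "t \<in> {0..T}" for t
  proof (rule borel_measurable_LIMSEQ_metric)
    fix n
    have [measurable]: "X (dyadic_floor T n t) \<in> borel_measurable M"
      by (intro X_measurable dyadic_floor_in T_pos t)
    show "(\<lambda>\<omega>. if \<omega> \<in> G then X (dyadic_floor T n t) \<omega> else x0) \<in> borel_measurable M"
      by measurable
  next
    fix \<omega>
    show "(\<lambda>n. if \<omega> \<in> G then X (dyadic_floor T n t) \<omega> else x0) \<longlonglongrightarrow> Y t \<omega>"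
      using Y(1)[of \<omega> t] t by (cases "\<omega> \<in> G") (auto simp: Y_def)
  qed
  \<comment> \<open>On the good event the values at the floors of \<open>t\<close> converge to
    \<open>Y t\<close>, and almost surely they converge to \<open>X t\<close>; limits are
    unique.\<close>
  have AE_eq: "AE \<omega> in M. Y t \<omega> = X t \<omega>" if t: "t \<in> {0..T}" for t
    using G_AE AE_tendsto_dyadic_floor[OF t]
    by eventually_elim (use Y(1) t LIMSEQ_unique in blast)
  obtain \<gamma> where "0 < \<gamma>" "\<gamma> < \<beta> / \<alpha>"
    using dense[OF divide_pos_pos[OF \<beta>_pos \<alpha>_pos]] by blast
  then have cont: "continuous_on {0..T} (\<lambda>t. Y t \<omega>)" for \<omega>
    using Holder locally_Holder_on_imp_continuous_on by blast
  have "Y t \<omega> \<in> S" if "t \<in> {0..T}" for t \<omega>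
    using Y(2)[of \<omega> t] that x0 by (cases "\<omega> \<in> G") (auto simp: Y_def)
  then show ?thesis
    unfolding continuous_locally_Holder_modification_def modification_def
    by (intro exI[of _ Y]) (auto intro: meas AE_eq cont Holder)
qed

end

section \<open>The last exceedance level and its tail\<close>

lemma max_dyadic_increment_gt_iff:
  "max_dyadic_increment T X n \<omega> > c \<longleftrightarrow> \<not> dyadic_bound T (\<lambda>t. X t \<omega>) n c"
  unfolding max_dyadic_increment_def dyadic_bound_def
  by (subst Max_gr_iff) (auto simp: dist_norm not_le)

text \<open>An exceeding level belongs to the set whose supremum is taken. Where the supremum is
  infinite, no \<open>n\<close> meets the premise.\<close>

lemma max_dyadic_increment_le_after_last_exceedance:
  assumes "enat n > last_exceedance \<gamma> T X \<omega>"
  shows "max_dyadic_increment T X n \<omega> \<le> T powr \<gamma> * 2 powr (- \<gamma> * real n)"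
proof (rule ccontr)
  assume "\<not> ?thesis"
  then have "enat n \<le> last_exceedance \<gamma> T X \<omega>"
    unfolding last_exceedance_def by (intro Sup_upper) auto
  with assms show False by simp
qed

text \<open>If all exceeding levels were below \<open>k\<close>, their supremum would be at most
  \<open>k - 1\<close>. The condition \<open>k \<ge> 1\<close> excludes the value 0 of the empty
  supremum.\<close>

lemma last_exceedance_geD:
  assumes "last_exceedance \<gamma> T X \<omega> \<ge> enat k" "k \<ge> 1"
  shows "\<exists>n\<ge>k. max_dyadic_increment T X n \<omega> > T powr \<gamma> * 2 powr (- \<gamma> * real n)"
proof (rule ccontr)
  assume "\<not> ?thesis"
  then have below: "n \<le> k - 1"
    if "max_dyadic_increment T X n \<omega> > T powr \<gamma> * 2 powr (- \<gamma> * real n)" for n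
    using that by (cases "n \<ge> k") auto
  have "last_exceedance \<gamma> T X \<omega> \<le> enat (k - 1)"
    unfolding last_exceedance_def using below by (intro Sup_least) auto
  with assms(1) have "enat k \<le> enat (k - 1)" by (rule order_trans)
  with assms(2) show False by simp
qed

text \<open>If \<open>2 e\<^sup>9\<^sup>/\<^sup>8 k (2\<^sup>d - 1) \<ge> 1\<close>, the right-hand side dominates the geometric tail.
  Otherwise \<open>k (2\<^sup>d - 1) \<le> 1/2\<close>, so \<open>2 powr (- k d) \<ge> 1/2\<close> and the right-hand side is at least 1.\<close>

lemma tail_bound_weaken:
  fixes p A d :: real
  assumes d: "d > 0" and A: "A \<ge> 0"
    and p: "p \<le> 1" "p \<le> A * 2 powr (- real k * d) / (1 - 2 powr (- d))"
  shows "p \<le> 2 * exp (9 / 8) * (real k * (A * (2 powr d - 1) / (1 - 2 powr (- d)) + 1) + 1)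
           * 2 powr (- real k * d)"
proof -
  define D :: real where "D = 2 powr d"
  define P :: real where "P = 2 powr (- real k * d)"
  define e :: real where "e = exp (9 / 8)"
  define W where "W = A / (1 - 2 powr (- d))"
  have D: "D > 1" using d powr_less_cancel_iff[of 2 0 d] by (simp add: D_def)
  have "2 powr (- d) < (1::real)" using d powr_less_cancel_iff[of 2 "- d" 0] by simp
  then have W: "W \<ge> 0" using A by (simp add: W_def)
  have P: "P > 0" by (simp add: P_def)
  have e: "e \<ge> 1" by (simp add: e_def)
  have "p \<le> 2 * e * (real k * (W * (D - 1) + 1) + 1) * P"
  proof (cases "2 * e * (real k * (D - 1)) \<ge> 1")
    case True
    have "p \<le> W * P" using p(2) by (simp add: W_def P_def)
    \<comment> \<open>Multiplying by a factor that is at least 1 produces the term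
      \<open>W * (D - 1)\<close> of the target.\<close>
    also have "\<dots> \<le> 2 * e * (real k * (D - 1)) * (W * P)"
      using mult_right_mono[OF True, of "W * P"] W P by simp
    also have "\<dots> = 2 * e * (real k * (W * (D - 1))) * P" by (simp add: mult_ac)
    also have "\<dots> \<le> 2 * e * (real k * (W * (D - 1) + 1) + 1) * P"
      using P e by (intro mult_right_mono mult_left_mono) (auto simp: algebra_simps)
    finally show ?thesis .
  next
    case False
    have "2 * (real k * (D - 1)) \<le> e * (2 * (real k * (D - 1)))"
      using mult_right_mono[OF e, of "2 * (real k * (D - 1))"] D by simp
    with False have "real k * (D - 1) \<le> 1 / 2" by (simp add: mult_ac)
    moreover have "d * ln 2 \<le> D - 1"
      using ln_le_minus_one[of D] D by (simp add: D_def ln_powr)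
    then have "real k * (d * ln 2) \<le> real k * (D - 1)" by (intro mult_left_mono) auto
    ultimately have "real k * (d * ln 2) \<le> 1 / 2" by linarith
    \<comment> \<open>\<open>P\<close> is the exponential of \<open>- k * d * ln 2\<close>, bounded
      below by its tangent at 0.\<close>
    moreover have "P \<ge> 1 - real k * (d * ln 2)"
      using exp_ge_add_one_self[of "- (real k * (d * ln 2))"] by (simp add: P_def powr_def mult_ac)
    ultimately have "2 * P \<ge> 1" by linarith
    moreover have "1 * 1 \<le> e * (real k * (W * (D - 1) + 1) + 1)"
      using e W D by (intro mult_mono) auto
    ultimately have "1 * 1 \<le> e * (real k * (W * (D - 1) + 1) + 1) * (2 * P)"
      by (intro mult_mono) auto
    with p(1) show ?thesis by (simp add: mult_ac)
  qed
  then show ?thesis by (simp add: W_def D_def P_def e_def)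
qed

(* A B-valued continuous modification need not exist when B is incomplete: the paths of the
   limit may leave B at random times.  The first conclusion therefore comes in two forms:
   B-valued for complete B, and for arbitrary B with values in the completion of B,
   i.e. the closure of the image of B under a linear isometry into a Banach space. *)
theorem theorem3:
  fixes M :: "'w measure"
    and X :: "real \<Rightarrow> 'w \<Rightarrow> 'b::{real_normed_vector, second_countable_topology}"
    and T \<alpha> \<beta> C :: real
  assumes "prob_space M"
    and "T > 0"
    and "\<forall>t\<in>{0..T}. X t \<in> borel_measurable M"
    and "\<alpha> > 0" and "\<beta> > 0" and "C > 0"
    and "\<forall>s\<in>{0..T}. \<forall>t\<in>{0..T}.
           (\<integral>\<^sup>+\<omega>. ennreal (norm (X t \<omega> - X s \<omega>) powr \<alpha>) \<partial>M)
             \<le> ennreal (C * \<bar>t - s\<bar> powr (1 + \<beta>))"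
  shows
    "(Topological_Spaces.complete (UNIV :: 'b set) \<longrightarrow>
        (\<exists>Y. continuous_locally_Holder_modification M T (\<beta> / \<alpha>) X Y))
     \<and>
     (\<forall>\<iota> :: 'b \<Rightarrow> 'c::banach. linear \<iota> \<and> (\<forall>x. norm (\<iota> x) = norm x) \<longrightarrow>
        (\<exists>Y. (\<forall>t\<in>{0..T}. \<forall>\<omega>\<in>space M. Y t \<omega> \<in> closure (range \<iota>)) \<and>
             continuous_locally_Holder_modification M T (\<beta> / \<alpha>) (\<lambda>t \<omega>. \<iota> (X t \<omega>)) Y))
     \<and>
     (\<forall>\<gamma>\<in>{0<..<\<beta> / \<alpha>}.
        (AE \<omega> in M. \<forall>n. enat n > last_exceedance \<gamma> T X \<omega> \<longrightarrow>
            max_dyadic_increment T X n \<omega> \<le> T powr \<gamma> * 2 powr (- \<gamma> * real n)) \<and>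
        (\<forall>k::nat. k \<ge> 1 \<longrightarrow>
            measure M {\<omega>\<in>space M. last_exceedance \<gamma> T X \<omega> \<ge> enat k}
              \<le> 2 * exp (9 / 8)
                * (real k * (C * T powr (1 + \<beta> - \<gamma> * \<alpha>) * (2 powr (\<beta> - \<alpha> * \<gamma>) - 1)
                             / (1 - 2 powr (- (\<beta> - \<alpha> * \<gamma>))) + 1) + 1)
                * 2 powr (- real k * (\<beta> - \<alpha> * \<gamma>))))"
  proof (intro conjI impI allI ballI)
  interpret prob_space M by fact
  have X_meas: "\<And>t. t \<in> {0..T} \<Longrightarrow> X t \<in> borel_measurable M" using assms(3) by blast
  have dist_meas: "(\<lambda>\<omega>. norm (X s \<omega> - X t \<omega>)) \<in> borel_measurable M"
    if [THEN X_meas, measurable]: "s \<in> {0..T}" "t \<in> {0..T}" for s t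
    by measurable
  interpret moment_increments M X T \<alpha> \<beta> C
    using assms X_meas dist_meas by unfold_locales (auto simp: dist_norm)
  show "\<exists>Y. continuous_locally_Holder_modification M T (\<beta> / \<alpha>) X Y"
    if "Topological_Spaces.complete (UNIV :: 'b set)"
    using exists_Holder_modification[OF that] by auto
  show "\<exists>Y. (\<forall>t\<in>{0..T}. \<forall>\<omega>\<in>space M. Y t \<omega> \<in> closure (range \<iota>)) \<and>
        continuous_locally_Holder_modification M T (\<beta> / \<alpha>) (\<lambda>t \<omega>. \<iota> (X t \<omega>)) Y"
    if "linear \<iota> \<and> (\<forall>x. norm (\<iota> x) = norm x)" for \<iota> :: "'b \<Rightarrow> 'c"
  proof -
    have dist_\<iota>: "dist (\<iota> x) (\<iota> y) = norm (x - y)" for x y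
      using that by (metis dist_norm linear_diff)
    have "continuous_on UNIV \<iota>"
      by (auto simp: continuous_on_iff dist_\<iota> simp flip: dist_norm)
    then have [measurable]: "\<iota> \<in> borel_measurable borel"
      by (rule borel_measurable_continuous_onI)
    \<comment> \<open>The isometry preserves distances, so their measurability and the moment bound
      carry over from the original process.\<close>
    interpret image: moment_increments M "\<lambda>t \<omega>. \<iota> (X t \<omega>)" T \<alpha> \<beta> C
      using assms dist_meas
      by unfold_locales (auto simp: dist_\<iota> intro: measurable_compose[OF X_meas])
    \<comment> \<open>Here \<open>S\<close> is the closure of the range, which is complete as a
      closed subset of a Banach space.\<close>
    show ?thesis
      by (rule image.exists_Holder_modification)
        (auto simp: complete_eq_closed intro: closure_subset[THEN subsetD])
  qed
  fix \<gamma> assume \<gamma>: "\<gamma> \<in> {0<..<\<beta> / \<alpha>}"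
  show "AE \<omega> in M. \<forall>n. enat n > last_exceedance \<gamma> T X \<omega> \<longrightarrow>
            max_dyadic_increment T X n \<omega> \<le> T powr \<gamma> * 2 powr (- \<gamma> * real n)"
    by (intro AE_I2 allI impI max_dyadic_increment_le_after_last_exceedance)
  fix k :: nat assume k: "k \<ge> 1"
  have "{\<omega>\<in>space M. last_exceedance \<gamma> T X \<omega> \<ge> enat k} \<subseteq> (\<Union>n. exceedance \<gamma> (n + k))"
  proof safe
    fix \<omega> assume "\<omega> \<in> space M" "last_exceedance \<gamma> T X \<omega> \<ge> enat k"
    with last_exceedance_geD[OF this(2) k] obtain n where "n \<ge> k" "\<omega> \<in> exceedance \<gamma> n"
      by (auto simp: exceedance_def max_dyadic_increment_gt_iff powr_power mult.commute)
    then show "\<omega> \<in> (\<Union>n. exceedance \<gamma> (n + k))" by (intro UN_I[of "n - k"]) auto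
  qed
  then have "prob {\<omega>\<in>space M. last_exceedance \<gamma> T X \<omega> \<ge> enat k} \<le> prob (\<Union>n. exceedance \<gamma> (n + k))"
    by (intro finite_measure_mono) auto
  also have "\<dots> \<le> C * T powr (1 + \<beta> - \<gamma> * \<alpha>) * 2 powr (- real k * (\<beta> - \<alpha> * \<gamma>))
      / (1 - 2 powr (- (\<beta> - \<alpha> * \<gamma>)))"
    using \<gamma> by (intro prob_exceedance_tail) auto
  finally show "prob {\<omega>\<in>space M. last_exceedance \<gamma> T X \<omega> \<ge> enat k}
              \<le> 2 * exp (9 / 8)
                * (real k * (C * T powr (1 + \<beta> - \<gamma> * \<alpha>) * (2 powr (\<beta> - \<alpha> * \<gamma>) - 1)
                             / (1 - 2 powr (- (\<beta> - \<alpha> * \<gamma>))) + 1) + 1)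
                * 2 powr (- real k * (\<beta> - \<alpha> * \<gamma>))"
    \<comment> \<open>The decay rate \<open>d\<close> is
      \<open>\<beta> - \<alpha> * \<gamma>\<close>, positive because
      \<open>\<gamma> < \<beta> / \<alpha>\<close>.\<close>
    using \<gamma> assms by (intro tail_bound_weaken) (auto simp: field_simps)
qed

end
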